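(* Let $f$ be a real-valued function whose domain contains $\mathbb{N}$ and such that $f(k+2)-f(k+1)>f(k+1)-f(k)$ for all $k\in\mathbb{N}$. If a graph $G$ maximizes $\Sigma_f$ over $\mathbb{G}(n,m)$, then $G$ is a threshold graph.
   Context: $\mathbb{N}=\{0,1,2,\dots\}$. Graphs are finite and simple, with vertex set $\{1,\dots,n\}$; $\mathbb{G}(n,m)$ is the set of graphs with $n$ vertices and $m$ edges. For a graph with degree sequence $d=(d_1,\dots,d_n)$ ($d_i$ the degree of vertex $i$), $\Sigma_f(d)=\sum_{i=1}^n f(d_i)$. A graph $G\in\mathbb{G}(n,m)$ maximizes $\Sigma_f$ over $\mathbb{G}(n,m)$ if its degree sequence attains the maximum of $\Sigma_f$ among all degree sequences of graphs in $\mathbb{G}(n,m)$. A graph is a threshold graph if it has the Chain Property: for any three distinct vertices $i,j,k$, if $d_i\ge d_j$ and $j$ and $k$ are adjacent, then $i$ and $k$ are also adjacent. *)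

theory Defs
  imports Complex_Main "HOL-Library.Ramsey"
begin

text \<open>
  A finite simple graph with vertex set \<open>{1..n}\<close> is identified with its edge set, a set of
  two-element subsets of \<open>{1..n}\<close>; vertices \<open>i\<close> and \<open>j\<close> are adjacent iff \<open>{i, j} \<in> E\<close>.
\<close>

definition graphs :: "nat \<Rightarrow> nat \<Rightarrow> nat set set set" where
  "graphs n m = {E. E \<subseteq> nsets {1..n} 2 \<and> card E = m}"

text \<open>
  The degree sequence of \<open>E\<close> is the function \<open>degree E\<close>, read on the indices \<open>1, \<dots>, n\<close>.
\<close>

definition degree :: "nat set set \<Rightarrow> nat \<Rightarrow> nat" where
  "degree E i = card {e \<in> E. i \<in> e}"

text \<open>
  A real-valued function whose domain contains the natural numbers enters only through its values
  at natural numbers, so it is represented by its restriction to \<open>nat\<close>.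
\<close>

definition Sigma_f :: "(nat \<Rightarrow> real) \<Rightarrow> nat \<Rightarrow> (nat \<Rightarrow> nat) \<Rightarrow> real" where
  "Sigma_f f n d = (\<Sum>i=1..n. f (d i))"

definition maximizes_Sigma :: "(nat \<Rightarrow> real) \<Rightarrow> nat \<Rightarrow> nat \<Rightarrow> nat set set \<Rightarrow> bool" where
  "maximizes_Sigma f n m E \<longleftrightarrow>
     E \<in> graphs n m \<and> (\<forall>E' \<in> graphs n m. Sigma_f f n (degree E') \<le> Sigma_f f n (degree E))"

definition threshold_graph :: "nat \<Rightarrow> nat set set \<Rightarrow> bool" where
  "threshold_graph n E \<longleftrightarrow>
     (\<forall>i \<in> {1..n}. \<forall>j \<in> {1..n}. \<forall>k \<in> {1..n}.
        i \<noteq> j \<and> j \<noteq> k \<and> i \<noteq> k \<longrightarrow>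
        degree E i \<ge> degree E j \<and> {j, k} \<in> E \<longrightarrow> {i, k} \<in> E)"

end

theory Submission
  imports Defs
begin

text \<open>
  If \<open>{j, k}\<close> is an edge, \<open>{i, k}\<close> is not, and \<open>d\<^sub>i \<ge> d\<^sub>j\<close>, then replacing the former by the latter
  changes the sum by \<open>(f (d\<^sub>i + 1) - f d\<^sub>i) - (f d\<^sub>j - f (d\<^sub>j - 1))\<close>, which is positive because the
  increments of \<open>f\<close> are strictly increasing; so the graph is not a maximizer.
\<close>

lemma degree_insert:
  assumes "finite E" "e \<notin> E"
  shows "degree (insert e E) v = degree E v + (if v \<in> e then 1 else 0)"
proof -
  have "{x \<in> insert e E. v \<in> x} = (if v \<in> e then insert e {x \<in> E. v \<in> x} else {x \<in> E. v \<in> x})"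
    by auto
  then show ?thesis
    using assms by (simp add: degree_def)
qed

lemma finite_graph: "E \<in> graphs n m \<Longrightarrow> finite E"
  unfolding graphs_def by (auto intro: finite_subset finite_imp_finite_nsets)

lemma graphs_insert_swap:
  assumes "insert e F \<in> graphs n m" "e \<notin> F" "e' \<notin> F" "e' \<in> nsets {1..n} 2"
  shows "insert e' F \<in> graphs n m"
proof -
  have "finite F"
    using finite_graph[OF assms(1)] by simp
  then show ?thesis
    using assms by (auto simp: graphs_def)
qed

text \<open>Adding an edge at \<open>k\<close> raises the other endpoint \<open>v\<close> from
  \<open>degree F v\<close> to its successor. Hence the two sums differ by the increment of
  \<open>f\<close> at \<open>degree F i\<close> minus that at \<open>degree F j\<close>.\<close>

lemma Sigma_f_swap_less:
  fixes f :: "nat \<Rightarrow> real"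
  assumes incr: "strict_mono (\<lambda>k. f (Suc k) - f k)"
    and F: "finite F" "{j, k} \<notin> F" "{i, k} \<notin> F"
    and ijk: "i \<in> {1..n}" "j \<in> {1..n}" "i \<noteq> j" "j \<noteq> k" "i \<noteq> k"
    and less: "degree F j < degree F i"
  shows "Sigma_f f n (degree (insert {j, k} F)) < Sigma_f f n (degree (insert {i, k} F))"
proof -
  let ?d = "degree (insert {j, k} F)" and ?d' = "degree (insert {i, k} F)"
  have split: "sum g {1..n} = g i + (g j + sum g ({1..n} - {i} - {j}))" for g :: "nat \<Rightarrow> real"
    using ijk sum.remove[of "{1..n}" i g] sum.remove[of "{1..n} - {i}" j g] by simp
  \<comment> \<open>The vertex \<open>k\<close> gains one in both graphs; any other remaining vertex
    lies on neither edge.\<close>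
  have rest: "(\<Sum>v\<in>{1..n} - {i} - {j}. f (?d v)) = (\<Sum>v\<in>{1..n} - {i} - {j}. f (?d' v))"
    using F by (intro sum.cong) (auto simp: degree_insert)
  have "f (Suc (degree F j)) - f (degree F j) < f (Suc (degree F i)) - f (degree F i)"
    using strict_monoD[OF incr less] .
  then show ?thesis
    using F ijk unfolding Sigma_f_def split rest by (simp add: degree_insert)
qed

theorem theorem2:
  fixes f :: "nat \<Rightarrow> real" and n m :: nat and G :: "nat set set"
  assumes "\<forall>k::nat. f (k + 2) - f (k + 1) > f (k + 1) - f k"
    and "maximizes_Sigma f n m G"
  shows "threshold_graph n G"
  unfolding threshold_graph_def
proof (intro ballI impI, elim conjE, rule ccontr)
  fix i j k
  assume ijk: "i \<in> {1..n}" "j \<in> {1..n}" "k \<in> {1..n}" "i \<noteq> j" "j \<noteq> k" "i \<noteq> k"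
    and le: "degree G j \<le> degree G i" and jk: "{j, k} \<in> G" and ik: "{i, k} \<notin> G"
  \<comment> \<open>\<open>F\<close> is the common part of \<open>G\<close> and its competitor: each
    arises by inserting one edge, so no degree is decremented in \<open>nat\<close>.\<close>
  define F where "F = G - {{j, k}}"
  have G: "G = insert {j, k} F" and notin: "{j, k} \<notin> F" "{i, k} \<notin> F"
    using jk ik by (auto simp: F_def)
  have graph: "insert {j, k} F \<in> graphs n m"
    using assms(2) G by (simp add: maximizes_Sigma_def)
  then have fin: "finite F"
    using finite_graph by fastforce
  have "{i, k} \<in> nsets {1..n} 2"
    using ijk by (simp add: nsets_def)
  then have "insert {i, k} F \<in> graphs n m"
    using graphs_insert_swap graph notin by blast
  then have max: "Sigma_f f n (degree (insert {i, k} F)) \<le> Sigma_f f n (degree G)"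
    using assms(2) by (simp add: maximizes_Sigma_def)
  have "strict_mono (\<lambda>k. f (Suc k) - f k)"
    using assms(1) by (simp add: strict_mono_Suc_iff)
  \<comment> \<open>Removing \<open>{j, k}\<close> lowers the degree of \<open>j\<close> but not
    that of \<open>i\<close>, so the weak inequality in \<open>G\<close> becomes strict in
    \<open>F\<close>.\<close>
  moreover have "degree F j < degree F i"
    using le ijk fin notin by (simp add: G degree_insert)
  ultimately have "Sigma_f f n (degree G) < Sigma_f f n (degree (insert {i, k} F))"
    using Sigma_f_swap_less fin notin ijk unfolding G by blast
  with max show False by simp
qed

end
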